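(* Let $\underline{\mathcal{A}}=(\underline{a}_{ijkl})$ and $\overline{\mathcal{A}}=(\overline{a}_{ijkl})$ be symmetric real $4$th order $3$-dimensional tensors with $\underline{\mathcal{A}}\le\overline{\mathcal{A}}$, and let $\mathcal{A}^I=[\underline{\mathcal{A}},\overline{\mathcal{A}}]$. Suppose $\underline{a}_{1111}=0$ and $\underline{a}_{2222}=\underline{a}_{3333}=1$. Then $\mathcal{A}^I$ is positive semi-definite if $\underline{a}_{1112}=\underline{a}_{1113}=\overline{a}_{1112}=\overline{a}_{1113}=0$ and one of the following conditions is satisfied: (a) $\underline{a}_{2223}=\underline{a}_{2333}=\underline{a}_{1123}=-1$, $\overline{a}_{2223}=\overline{a}_{2333}=\overline{a}_{1123}=1$, $\underline{a}_{1222}=\underline{a}_{1333}=\overline{a}_{1222}=\overline{a}_{1333}=0$, $\underline{a}_{1223}=\underline{a}_{1233}=\overline{a}_{1223}=\overline{a}_{1233}=0$, and $\underline{a}_{iijj}\ge1$ for all $i,j\in\{1,2,3\}$, $i\ne j$; (b) $\underline{a}_{2333}=-1$, $\overline{a}_{2333}=1$, $\underline{a}_{1222}=\underline{a}_{2223}=\underline{a}_{1333}=\overline{a}_{1222}=\overline{a}_{2223}=\overline{a}_{1333}=0$, $\underline{a}_{1223}=-1$, $\overline{a}_{1223}=1$, $\underline{a}_{1123}=\underline{a}_{1233}=\overline{a}_{1123}=\overline{a}_{1233}=0$, $\underline{a}_{1133}\ge1$, $\underline{a}_{2233}\ge1$ and $\underline{a}_{1122}\ge\frac23$.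
   Context: A tensor $\mathcal{A}=(a_{ijkl})$, $i,j,k,l\in\{1,2,3\}$, is symmetric if its entries are invariant under all permutations of the indices (so a condition on one entry applies to all entries with permuted indices). Inequalities between tensors are entrywise, and $[\underline{\mathcal{A}},\overline{\mathcal{A}}]$ is the set of all real $4$th order $3$-dimensional tensors $\mathcal{A}$ with $\underline{\mathcal{A}}\le\mathcal{A}\le\overline{\mathcal{A}}$ (interval tensor). A tensor $\mathcal{A}$ is positive semi-definite if $\mathcal{A}x^4=\sum_{i,j,k,l=1}^3a_{ijkl}x_ix_jx_kx_l\ge0$ for all $x\in\mathbb{R}^3\setminus\{0\}$. An interval tensor is positive semi-definite if every tensor in it is. *)

theory Defs
  imports "HOL-Analysis.Analysis"
begin

text \<open>
  The entry $a_{ijkl}$ of a tensor \<open>A\<close> is \<open>A $ i $ j $ k $ l\<close>. In the index type \<^typ>\<open>3\<close> the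
  elements 1, 2, 3 are distinct and exhaust the type (3 is identified with 0).
\<close>

type_synonym 'n tensor4 = "real ^ 'n ^ 'n ^ 'n ^ 'n"

text \<open>An index tuple is a function \<open>f\<close> on the positions 1, 2, 3, 4.\<close>

definition symmetric_tensor :: "'n::finite tensor4 \<Rightarrow> bool" where
  "symmetric_tensor A \<longleftrightarrow>
     (\<forall>(f :: nat \<Rightarrow> 'n) p. p permutes {1..4} \<longrightarrow>
        A $ f (p 1) $ f (p 2) $ f (p 3) $ f (p 4) = A $ f 1 $ f 2 $ f 3 $ f 4)"

definition tensor_form :: "'n::finite tensor4 \<Rightarrow> real ^ 'n \<Rightarrow> real" where
  "tensor_form A x =
     (\<Sum>i\<in>UNIV. \<Sum>j\<in>UNIV. \<Sum>k\<in>UNIV. \<Sum>l\<in>UNIV. A $ i $ j $ k $ l * x $ i * x $ j * x $ k * x $ l)"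

definition psd_tensor :: "'n::finite tensor4 \<Rightarrow> bool" where
  "psd_tensor A \<longleftrightarrow> (\<forall>x. x \<noteq> 0 \<longrightarrow> tensor_form A x \<ge> 0)"

text \<open>
  The library order on vectors is componentwise, so on tensors \<open>\<le>\<close> is entrywise and the set
  interval \<open>{L..U}\<close> is the interval tensor with bounds \<open>L\<close> and \<open>U\<close>; it also contains
  non-symmetric tensors.
\<close>

lemma tensor_le_iff:
  fixes A B :: "'n::finite tensor4"
  shows "A \<le> B \<longleftrightarrow> (\<forall>i j k l. A $ i $ j $ k $ l \<le> B $ i $ j $ k $ l)"
  by (simp add: less_eq_vec_def)

definition psd_interval_tensor :: "'n::finite tensor4 set \<Rightarrow> bool" where
  "psd_interval_tensor AI \<longleftrightarrow> (\<forall>A\<in>AI. psd_tensor A)"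

end

theory Submission
  imports Defs
begin

text \<open>
  The value of the form at \<open>x\<close> is bounded below over the whole interval tensor by the value at
  \<open>(\<bar>x\<^sub>1\<bar>, \<bar>x\<^sub>2\<bar>, \<bar>x\<^sub>3\<bar>)\<close> of a single symmetric tensor: a monomial that is a product of two squares is
  nonnegative, so its smallest contribution has the lower bound \<open>L\<close> as coefficient; any other
  monomial may have either sign, and its contribution is at least minus its absolute value times
  the largest modulus in the coefficient interval (lemma \<open>tensor_form_ge_worst_case\<close>). The bound
  is taken entry by entry, so it covers the non-symmetric tensors in the interval as well.

  Positive semi-definiteness is thus reduced to one inequality between polynomials in each case.
  With \<open>(x, y, z)\<close> for the absolute values, these are
  \<open>y^4 + z^4 - 4y^3z - 4yz^3 + 6(x^2y^2 + x^2z^2 + y^2z^2) - 12x^2yz \<ge> 0\<close> in case (a) and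
  \<open>y^4 + z^4 - 4yz^3 + 4x^2y^2 + 6x^2z^2 + 6y^2z^2 - 12xy^2z \<ge> 0\<close> in case (b). Here every
  \<open>a\<^sub>i\<^sub>i\<^sub>j\<^sub>j\<close> has its least admissible value; a larger one only adds a nonnegative term. Both left-hand sides
  are sums of squares; the decompositions are in \<open>quartic_a_nonneg\<close> and \<open>quartic_b_nonneg\<close>.
\<close>

section \<open>Symmetry and the form in three variables\<close>

text \<open>
  The adjacent transpositions generate all permutations of the four positions. Invariance under
  these three is easier to verify than the full symmetry, and enough to collect equal monomials.
\<close>

definition swap_invariant :: "'n::finite tensor4 \<Rightarrow> bool" where
  "swap_invariant A \<longleftrightarrow> (\<forall>i j k l.
     A $ j $ i $ k $ l = A $ i $ j $ k $ l \<and>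
     A $ i $ k $ j $ l = A $ i $ j $ k $ l \<and>
     A $ i $ j $ l $ k = A $ i $ j $ k $ l)"

lemma symmetric_tensor_imp_swap_invariant:
  fixes A :: "'n::finite tensor4"
  assumes "symmetric_tensor A"
  shows "swap_invariant A"
  unfolding swap_invariant_def
proof (intro allI)
  fix i j k l :: 'n
  define f :: "nat \<Rightarrow> 'n" where "f = (\<lambda>m. if m = 1 then i else if m = 2 then j else if m = 3 then k else l)"
  have perm: "A $ f (p 1) $ f (p 2) $ f (p 3) $ f (p 4) = A $ f 1 $ f 2 $ f 3 $ f 4"
    if "p permutes {1..4}" for p
    using assms that unfolding symmetric_tensor_def by blast
  have swap: "Transposition.transpose a b permutes {1..4}" if "a \<in> {1..4}" "b \<in> {1..4}" for a b :: nat
    using that by (rule permutes_swap_id)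
  show "A $ j $ i $ k $ l = A $ i $ j $ k $ l \<and>
        A $ i $ k $ j $ l = A $ i $ j $ k $ l \<and>
        A $ i $ j $ l $ k = A $ i $ j $ k $ l"
    using perm[OF swap, of 1 2] perm[OF swap, of 2 3] perm[OF swap, of 3 4]
    by (simp add: f_def Transposition.transpose_def)
qed

lemma tensor_form_3_swap_invariant:
  fixes A :: "3 tensor4"
  assumes "swap_invariant A"
  shows "tensor_form A x =
      A $ 1 $ 1 $ 1 $ 1 * x $ 1 ^ 4 + A $ 2 $ 2 $ 2 $ 2 * x $ 2 ^ 4 + A $ 3 $ 3 $ 3 $ 3 * x $ 3 ^ 4
    + 4 * (A $ 1 $ 1 $ 1 $ 2 * x $ 1 ^ 3 * x $ 2 + A $ 1 $ 1 $ 1 $ 3 * x $ 1 ^ 3 * x $ 3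
         + A $ 1 $ 2 $ 2 $ 2 * x $ 1 * x $ 2 ^ 3 + A $ 2 $ 2 $ 2 $ 3 * x $ 2 ^ 3 * x $ 3
         + A $ 1 $ 3 $ 3 $ 3 * x $ 1 * x $ 3 ^ 3 + A $ 2 $ 3 $ 3 $ 3 * x $ 2 * x $ 3 ^ 3)
    + 6 * (A $ 1 $ 1 $ 2 $ 2 * x $ 1 ^ 2 * x $ 2 ^ 2 + A $ 1 $ 1 $ 3 $ 3 * x $ 1 ^ 2 * x $ 3 ^ 2
         + A $ 2 $ 2 $ 3 $ 3 * x $ 2 ^ 2 * x $ 3 ^ 2)
    + 12 * (A $ 1 $ 1 $ 2 $ 3 * x $ 1 ^ 2 * x $ 2 * x $ 3 + A $ 1 $ 2 $ 2 $ 3 * x $ 1 * x $ 2 ^ 2 * x $ 3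
         + A $ 1 $ 2 $ 3 $ 3 * x $ 1 * x $ 2 * x $ 3 ^ 2)"
proof -
  have s: "A $ j $ i $ k $ l = A $ i $ j $ k $ l" "A $ i $ k $ j $ l = A $ i $ j $ k $ l"
    "A $ i $ j $ l $ k = A $ i $ j $ k $ l" for i j k l
    using assms unfolding swap_invariant_def by blast+
  \<comment> \<open>Each rule moves a smaller index to the left past an adjacent larger one; together they sort every tuple.\<close>
  note sort =
    s(1)[where i = 1 and j = 2] s(1)[where i = 1 and j = 3] s(1)[where i = 2 and j = 3]
    s(2)[where j = 1 and k = 2] s(2)[where j = 1 and k = 3] s(2)[where j = 2 and k = 3]
    s(3)[where k = 1 and l = 2] s(3)[where k = 1 and l = 3] s(3)[where k = 2 and l = 3]
  show ?thesis
    unfolding tensor_form_def sum_3 sort by algebra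
qed

section \<open>The worst tensor of an interval\<close>

text \<open>The index tuples whose monomial is a product of two squares.\<close>

definition paired :: "'n \<Rightarrow> 'n \<Rightarrow> 'n \<Rightarrow> 'n \<Rightarrow> bool" where
  "paired i j k l \<longleftrightarrow> i = j \<and> k = l \<or> i = k \<and> j = l \<or> i = l \<and> j = k"

definition worst_case :: "'n::finite tensor4 \<Rightarrow> 'n tensor4 \<Rightarrow> 'n tensor4" where
  "worst_case L U = (\<chi> i j k l. if paired i j k l then L $ i $ j $ k $ l
     else - max \<bar>L $ i $ j $ k $ l\<bar> \<bar>U $ i $ j $ k $ l\<bar>)"

lemma worst_case_nth:
  "worst_case L U $ i $ j $ k $ l = (if paired i j k l then L $ i $ j $ k $ l
     else - max \<bar>L $ i $ j $ k $ l\<bar> \<bar>U $ i $ j $ k $ l\<bar>)"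
  by (simp add: worst_case_def)

lemma swap_invariant_worst_case:
  assumes "swap_invariant L" and "swap_invariant U"
  shows "swap_invariant (worst_case L U)"
proof -
  have "paired j i k l = paired i j k l" "paired i k j l = paired i j k l"
    "paired i j l k = paired i j k l" for i j k l :: 'a
    unfolding paired_def by auto
  then show ?thesis
    using assms unfolding swap_invariant_def worst_case_nth by simp
qed

lemma paired_monomial_nonneg:
  fixes x :: "real ^ 'n"
  assumes "paired i j k l"
  shows "0 \<le> x $ i * x $ j * x $ k * x $ l"
proof -
  have "x $ i * x $ j * x $ k * x $ l = (x $ i * x $ j) * (x $ k * x $ l)"
    "x $ i * x $ j * x $ k * x $ l = (x $ i * x $ k) * (x $ j * x $ l)"
    "x $ i * x $ j * x $ k * x $ l = (x $ i * x $ l) * (x $ j * x $ k)"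
    by simp_all
  with assms show ?thesis
    unfolding paired_def by (metis mult_nonneg_nonneg zero_le_square)
qed

text \<open>
  The bound holds for every summand: a coefficient in \<open>[L, U]\<close> is at least \<open>L\<close>, which settles the
  nonnegative monomials, and has modulus at most the larger of \<open>\<bar>L\<bar>\<close> and \<open>\<bar>U\<bar>\<close>, which settles the
  others.
\<close>

lemma tensor_form_ge_worst_case:
  fixes A :: "'n::finite tensor4"
  assumes "A \<in> {L..U}"
  shows "tensor_form (worst_case L U) (\<chi> i. \<bar>x $ i\<bar>) \<le> tensor_form A x"
proof -
  have "worst_case L U $ i $ j $ k $ l * \<bar>x $ i\<bar> * \<bar>x $ j\<bar> * \<bar>x $ k\<bar> * \<bar>x $ l\<bar>
      \<le> A $ i $ j $ k $ l * x $ i * x $ j * x $ k * x $ l" for i j k l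
  proof -
    let ?a = "A $ i $ j $ k $ l" and ?m = "x $ i * x $ j * x $ k * x $ l"
    have bounds: "L $ i $ j $ k $ l \<le> ?a" "?a \<le> U $ i $ j $ k $ l"
      using assms by (auto simp: tensor_le_iff)
    have "worst_case L U $ i $ j $ k $ l * \<bar>?m\<bar> \<le> ?a * ?m"
    proof (cases "paired i j k l")
      case True
      then show ?thesis
        using paired_monomial_nonneg[OF True, of x] bounds
        by (simp add: worst_case_nth mult_right_mono)
    next
      case False
      have "\<bar>?a\<bar> \<le> max \<bar>L $ i $ j $ k $ l\<bar> \<bar>U $ i $ j $ k $ l\<bar>"
        using bounds by linarith
      then have "\<bar>?a * ?m\<bar> \<le> max \<bar>L $ i $ j $ k $ l\<bar> \<bar>U $ i $ j $ k $ l\<bar> * \<bar>?m\<bar>"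
        by (subst abs_mult) (rule mult_right_mono, auto)
      then show ?thesis
        using False by (simp add: worst_case_nth)
    qed
    then show ?thesis
      by (simp add: abs_mult mult.assoc)
  qed
  then show ?thesis
    unfolding tensor_form_def by (simp add: sum_mono)
qed

lemma psd_interval_tensor_if_worst_case:
  fixes L U :: "'n::finite tensor4"
  assumes "\<And>y. 0 \<le> tensor_form (worst_case L U) y"
  shows "psd_interval_tensor {L..U}"
  unfolding psd_interval_tensor_def psd_tensor_def
proof (intro ballI allI impI)
  fix A x
  assume "A \<in> {L..U}"
  have "0 \<le> tensor_form (worst_case L U) (\<chi> i. \<bar>x $ i\<bar>)"
    by (rule assms)
  also have "\<dots> \<le> tensor_form A x"
    using \<open>A \<in> {L..U}\<close> by (rule tensor_form_ge_worst_case)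
  finally show "0 \<le> tensor_form A x" .
qed

section \<open>The two extremal quartics\<close>

lemma quartic_a_nonneg:
  fixes x y z :: real
  shows "0 \<le> y ^ 4 + z ^ 4 - 4 * (y ^ 3 * z + y * z ^ 3)
    + 6 * (x\<^sup>2 * y\<^sup>2 + x\<^sup>2 * z\<^sup>2 + y\<^sup>2 * z\<^sup>2) - 12 * (x\<^sup>2 * y * z)" (is "0 \<le> ?p")
proof -
  have "?p = ((y - z)\<^sup>2)\<^sup>2 + 6 * (x * (y - z))\<^sup>2"
    by algebra
  also have "0 \<le> \<dots>"
    by simp
  finally show ?thesis .
qed

text \<open>
  The first two squares below produce \<open>z^4 - 4yz^3\<close>, \<open>y^4\<close> and two thirds of the negative term
  \<open>-12xy^2z\<close>. What remains is a positive definite quadratic form in \<open>xy\<close>, \<open>xz\<close>, \<open>yz\<close>, and the last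
  three squares come from completing squares in it, starting with \<open>yz\<close>.
\<close>

lemma quartic_b_nonneg:
  fixes x y z :: real
  shows "0 \<le> y ^ 4 + z ^ 4 - 4 * (y * z ^ 3)
    + 4 * (x\<^sup>2 * y\<^sup>2) + 6 * (x\<^sup>2 * z\<^sup>2 + y\<^sup>2 * z\<^sup>2) - 12 * (x * y\<^sup>2 * z)" (is "0 \<le> ?p")
proof -
  have "2 * ?p = 2 * (z\<^sup>2 - 2 * y * z + x * y)\<^sup>2 + 2 * (y\<^sup>2 - 2 * x * z)\<^sup>2
      + (2 * y * z - 2 * x * y - x * z)\<^sup>2 + 2 * (x * y - x * z)\<^sup>2 + (x * z)\<^sup>2"
    by algebra
  also have "0 \<le> \<dots>"
    by simp
  finally show ?thesis
    by simp
qed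

section \<open>Positive semi-definite interval tensors\<close>

theorem theorem5p3:
  fixes L U :: "3 tensor4"
  assumes "symmetric_tensor L" and "symmetric_tensor U" and "L \<le> U"
    and "L $ 1 $ 1 $ 1 $ 1 = 0" and "L $ 2 $ 2 $ 2 $ 2 = 1" and "L $ 3 $ 3 $ 3 $ 3 = 1"
    and "L $ 1 $ 1 $ 1 $ 2 = 0" and "L $ 1 $ 1 $ 1 $ 3 = 0"
    and "U $ 1 $ 1 $ 1 $ 2 = 0" and "U $ 1 $ 1 $ 1 $ 3 = 0"
    and
     "(L $ 2 $ 2 $ 2 $ 3 = -1 \<and> L $ 2 $ 3 $ 3 $ 3 = -1 \<and> L $ 1 $ 1 $ 2 $ 3 = -1 \<and>
       U $ 2 $ 2 $ 2 $ 3 = 1 \<and> U $ 2 $ 3 $ 3 $ 3 = 1 \<and> U $ 1 $ 1 $ 2 $ 3 = 1 \<and>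
       L $ 1 $ 2 $ 2 $ 2 = 0 \<and> L $ 1 $ 3 $ 3 $ 3 = 0 \<and>
       U $ 1 $ 2 $ 2 $ 2 = 0 \<and> U $ 1 $ 3 $ 3 $ 3 = 0 \<and>
       L $ 1 $ 2 $ 2 $ 3 = 0 \<and> L $ 1 $ 2 $ 3 $ 3 = 0 \<and>
       U $ 1 $ 2 $ 2 $ 3 = 0 \<and> U $ 1 $ 2 $ 3 $ 3 = 0 \<and>
       (\<forall>i j. i \<noteq> j \<longrightarrow> L $ i $ i $ j $ j \<ge> 1))
      \<or>
      (L $ 2 $ 3 $ 3 $ 3 = -1 \<and> U $ 2 $ 3 $ 3 $ 3 = 1 \<and>
       L $ 1 $ 2 $ 2 $ 2 = 0 \<and> L $ 2 $ 2 $ 2 $ 3 = 0 \<and> L $ 1 $ 3 $ 3 $ 3 = 0 \<and>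
       U $ 1 $ 2 $ 2 $ 2 = 0 \<and> U $ 2 $ 2 $ 2 $ 3 = 0 \<and> U $ 1 $ 3 $ 3 $ 3 = 0 \<and>
       L $ 1 $ 2 $ 2 $ 3 = -1 \<and> U $ 1 $ 2 $ 2 $ 3 = 1 \<and>
       L $ 1 $ 1 $ 2 $ 3 = 0 \<and> L $ 1 $ 2 $ 3 $ 3 = 0 \<and>
       U $ 1 $ 1 $ 2 $ 3 = 0 \<and> U $ 1 $ 2 $ 3 $ 3 = 0 \<and>
       L $ 1 $ 1 $ 3 $ 3 \<ge> 1 \<and> L $ 2 $ 2 $ 3 $ 3 \<ge> 1 \<and> L $ 1 $ 1 $ 2 $ 2 \<ge> 2 / 3)"
  shows "psd_interval_tensor {L..U}"
proof (rule psd_interval_tensor_if_worst_case)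
  fix v :: "real ^ 3"
  define x y z where "x = v $ 1" and "y = v $ 2" and "z = v $ 3"
  let ?W = "worst_case L U"
  have "swap_invariant ?W"
    using assms(1,2) by (intro swap_invariant_worst_case symmetric_tensor_imp_swap_invariant)
  note form = tensor_form_3_swap_invariant[OF this, of v, folded x_def y_def z_def]
  have weaken: "c * (a\<^sup>2 * b\<^sup>2) \<le> w * (a\<^sup>2 * b\<^sup>2)" if "c \<le> w" for a b c w :: real
    using that by (intro mult_right_mono) auto
  from assms(11) show "0 \<le> tensor_form ?W v"
  proof (elim disjE)
    assume a: "L $ 2 $ 2 $ 2 $ 3 = -1 \<and> L $ 2 $ 3 $ 3 $ 3 = -1 \<and> L $ 1 $ 1 $ 2 $ 3 = -1 \<and>
       U $ 2 $ 2 $ 2 $ 3 = 1 \<and> U $ 2 $ 3 $ 3 $ 3 = 1 \<and> U $ 1 $ 1 $ 2 $ 3 = 1 \<and>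
       L $ 1 $ 2 $ 2 $ 2 = 0 \<and> L $ 1 $ 3 $ 3 $ 3 = 0 \<and>
       U $ 1 $ 2 $ 2 $ 2 = 0 \<and> U $ 1 $ 3 $ 3 $ 3 = 0 \<and>
       L $ 1 $ 2 $ 2 $ 3 = 0 \<and> L $ 1 $ 2 $ 3 $ 3 = 0 \<and>
       U $ 1 $ 2 $ 2 $ 3 = 0 \<and> U $ 1 $ 2 $ 3 $ 3 = 0 \<and>
       (\<forall>i j. i \<noteq> j \<longrightarrow> L $ i $ i $ j $ j \<ge> 1)"
    then have "1 \<le> L $ 1 $ 1 $ 2 $ 2" "1 \<le> L $ 1 $ 1 $ 3 $ 3" "1 \<le> L $ 2 $ 2 $ 3 $ 3"
      by simp_all
    note squares = this[THEN weaken]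
    have "tensor_form ?W v = y ^ 4 + z ^ 4 - 4 * (y ^ 3 * z + y * z ^ 3)
      + 6 * (L $ 1 $ 1 $ 2 $ 2 * (x\<^sup>2 * y\<^sup>2) + L $ 1 $ 1 $ 3 $ 3 * (x\<^sup>2 * z\<^sup>2)
           + L $ 2 $ 2 $ 3 $ 3 * (y\<^sup>2 * z\<^sup>2)) - 12 * (x\<^sup>2 * y * z)"
      using a assms(4-10) by (simp add: form worst_case_nth paired_def mult.assoc)
    then show ?thesis
      using quartic_a_nonneg[of y z x] squares(1)[of x y] squares(2)[of x z] squares(3)[of y z]
      by argo
  next
    assume b: "L $ 2 $ 3 $ 3 $ 3 = -1 \<and> U $ 2 $ 3 $ 3 $ 3 = 1 \<and>
       L $ 1 $ 2 $ 2 $ 2 = 0 \<and> L $ 2 $ 2 $ 2 $ 3 = 0 \<and> L $ 1 $ 3 $ 3 $ 3 = 0 \<and>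
       U $ 1 $ 2 $ 2 $ 2 = 0 \<and> U $ 2 $ 2 $ 2 $ 3 = 0 \<and> U $ 1 $ 3 $ 3 $ 3 = 0 \<and>
       L $ 1 $ 2 $ 2 $ 3 = -1 \<and> U $ 1 $ 2 $ 2 $ 3 = 1 \<and>
       L $ 1 $ 1 $ 2 $ 3 = 0 \<and> L $ 1 $ 2 $ 3 $ 3 = 0 \<and>
       U $ 1 $ 1 $ 2 $ 3 = 0 \<and> U $ 1 $ 2 $ 3 $ 3 = 0 \<and>
       L $ 1 $ 1 $ 3 $ 3 \<ge> 1 \<and> L $ 2 $ 2 $ 3 $ 3 \<ge> 1 \<and> L $ 1 $ 1 $ 2 $ 2 \<ge> 2 / 3"
    then have "2 / 3 \<le> L $ 1 $ 1 $ 2 $ 2" "1 \<le> L $ 1 $ 1 $ 3 $ 3" "1 \<le> L $ 2 $ 2 $ 3 $ 3"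
      by simp_all
    note squares = this[THEN weaken]
    have "tensor_form ?W v = y ^ 4 + z ^ 4 - 4 * (y * z ^ 3)
      + 6 * (L $ 1 $ 1 $ 2 $ 2 * (x\<^sup>2 * y\<^sup>2) + L $ 1 $ 1 $ 3 $ 3 * (x\<^sup>2 * z\<^sup>2)
           + L $ 2 $ 2 $ 3 $ 3 * (y\<^sup>2 * z\<^sup>2)) - 12 * (x * y\<^sup>2 * z)"
      using b assms(4-10) by (simp add: form worst_case_nth paired_def mult.assoc)
    then show ?thesis
      using quartic_b_nonneg[of y z x] squares(1)[of x y] squares(2)[of x z] squares(3)[of y z]
      by argo
  qed
qed

end
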